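(* Let $G=(V,E)$ be a graph, let $k\in\mathbb{N}$, let $\beta,J$ be real and let $x=e^{\beta J}-1$. Then $$B_{r,q}(G;x,k)=\sum_{\sigma:V\to\{0,\ldots,k-1\}}e^{\beta\sum_{uv\in E}J\,\delta(\sigma(u),\sigma(v))}\;r^{\sum_{v\in V}q^{\sigma(v)}}.$$
   Context: Graphs are finite and may have multiple edges and loops; sums over $uv\in E$ are over edges counted with multiplicity. $\delta$ is the Kronecker delta: $\delta(a,b)=1$ if $a=b$ and $0$ otherwise. The variable $q$ ranges over the non-negative integers and $r$ over the reals (with $0^0=1$). For $A\subseteq E$, $\mathcal{C}(A)$ denotes the set of connected components of the spanning subgraph $(V,A)$, and $|C|$ denotes the number of vertices of $C\in\mathcal{C}(A)$. The $(r,q)$-dichromatic function is $$B_{r,q}(G;x,k):=\sum_{A\subseteq E}x^{|A|}\prod_{C\in\mathcal{C}(A)}\sum_{i=0}^{k-1}r^{|C|q^i}.$$ *)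

theory Defs
  imports Complex_Main "HOL-Library.FuncSet" "HOL-Library.Uprod"
begin

text \<open>
  Edges are abstract objects, each with an unordered pair of end vertices: distinct edges may have
  the same ends (multiple edges), and the two ends may coincide (loops).
\<close>

record ('v, 'e) multigraph =
  verts :: "'v set"
  edges :: "'e set"
  ends :: "'e \<Rightarrow> 'v uprod"

locale finite_multigraph =
  fixes G :: "('v, 'e) multigraph"
  assumes finite_verts: "finite (verts G)"
    and finite_edges: "finite (edges G)"
    and ends_in_verts: "e \<in> edges G \<Longrightarrow> set_uprod (ends G e) \<subseteq> verts G"

definition adjacent :: "('v, 'e) multigraph \<Rightarrow> 'v \<Rightarrow> 'v \<Rightarrow> bool" where
  "adjacent G u v \<longleftrightarrow> (\<exists>e \<in> edges G. ends G e = Upair u v)"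

definition connectivity :: "('v, 'e) multigraph \<Rightarrow> ('v \<times> 'v) set" where
  "connectivity G = {(u, v). u \<in> verts G \<and> v \<in> verts G \<and> (adjacent G)\<^sup>*\<^sup>* u v}"

text \<open>A connected component is represented by its vertex set.\<close>

definition components :: "('v, 'e) multigraph \<Rightarrow> 'v set set" where
  "components G = verts G // connectivity G"

definition spanning_subgraph :: "('v, 'e) multigraph \<Rightarrow> 'e set \<Rightarrow> ('v, 'e) multigraph" where
  "spanning_subgraph G A = G\<lparr>edges := A\<rparr>"

definition dichromatic ::
    "real \<Rightarrow> nat \<Rightarrow> ('v, 'e) multigraph \<Rightarrow> real \<Rightarrow> nat \<Rightarrow> real" where
  "dichromatic r q G x k =
    (\<Sum>A \<in> Pow (edges G). x ^ card A *
      (\<Prod>C \<in> components (spanning_subgraph G A). \<Sum>i<k. r ^ (card C * q ^ i)))"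

text \<open>
  The Kronecker delta as a commutative function, so that it can be applied to an unordered pair.
\<close>

lift_definition kronecker :: "('c, real) commute" is "\<lambda>a b. if a = b then 1 else 0"
  by auto

definition edge_delta :: "('v, 'e) multigraph \<Rightarrow> ('v \<Rightarrow> 'c) \<Rightarrow> 'e \<Rightarrow> real" where
  "edge_delta G \<sigma> e = case_uprod kronecker (map_uprod \<sigma> (ends G e))"

lemma edge_delta_Upair:
  assumes "ends G e = Upair u v"
  shows "edge_delta G \<sigma> e = (if \<sigma> u = \<sigma> v then 1 else 0)"
  unfolding edge_delta_def using assms by (simp add: kronecker.rep_eq)

lemma equiv_connectivity: "equiv (verts G) (connectivity G)"
proof (rule equivI)
  have "symp (adjacent G)\<^sup>*\<^sup>*"
    by (rule symp_rtranclp) (metis sympI adjacent_def Upair_inject)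
  then show "sym (connectivity G)"
    by (auto simp: connectivity_def intro!: symI dest: sympD)
  show "trans (connectivity G)"
    by (auto simp: connectivity_def intro!: transI)
qed (auto simp: connectivity_def refl_on_def)

end

theory Submission
  imports Defs
begin

text \<open>
  Since each Kronecker delta is 0 or 1, the Boltzmann weight factors as
  \<open>\<Prod>e. (1 + x * \<delta> e)\<close>; expanding the product gives a sum over edge sets \<open>A\<close>
  of \<open>x ^ card A\<close>, restricted to the colourings that are constant along every edge of \<open>A\<close>. These
  are the colourings constant on the components of the spanning subgraph of \<open>A\<close>, so for fixed \<open>A\<close>
  the sum over colourings factors over the components.
\<close>

text \<open>A map constant on the classes of \<open>R\<close> is the same thing as a map on the
  quotient \<open>V // R\<close>. Giving colour \<open>i\<close> to a whole class \<open>C\<close>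
  contributes one factor \<open>w i\<close> per element of \<open>C\<close>, and distributing the
  product over classes lists all maps on the quotient.\<close>

lemma sum_prod_respects_equiv:
  fixes w :: "'b \<Rightarrow> 'c::comm_semiring_1"
  assumes equiv: "equiv V R" and "finite V" and "finite S"
  shows "(\<Sum>\<sigma> | \<sigma> \<in> V \<rightarrow>\<^sub>E S \<and> (\<forall>(u, v) \<in> R. \<sigma> u = \<sigma> v). \<Prod>v\<in>V. w (\<sigma> v)) =
    (\<Prod>C\<in>V // R. \<Sum>i\<in>S. w i ^ card C)"
proof -
  have R: "R \<subseteq> V \<times> V" and finC: "finite (V // R)"
    using equiv \<open>finite V\<close> by (auto simp: equiv_def intro: finite_quotient)
  have class_eq: "R `` {v} = C" if v: "v \<in> C" and C: "C \<in> V // R" for v C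
  proof -
    obtain u where "C = R `` {u}" using C by (rule quotientE)
    then show ?thesis using v equiv_class_eq[OF equiv, of u v] by simp
  qed
  have rep: "(SOME v. v \<in> C) \<in> C" "(SOME v. v \<in> C) \<in> V" "R `` {SOME v. v \<in> C} = C"
    if C: "C \<in> V // R" for C
  proof -
    show "(SOME v. v \<in> C) \<in> C"
      using in_quotient_imp_non_empty[OF equiv C] by (simp add: some_in_eq)
    then show "(SOME v. v \<in> C) \<in> V"
      using in_quotient_imp_subset[OF equiv C] by blast
    show "R `` {SOME v. v \<in> C} = C"
      using \<open>(SOME v. v \<in> C) \<in> C\<close> C by (rule class_eq)
  qed
  have same_class: "R `` {u} = R `` {v}" if "(u, v) \<in> R" for u v
    using equiv_class_eq[OF equiv that] .
  \<comment> \<open>The product over \<open>V\<close> is grouped by classes, which partition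
    \<open>V\<close>; on each class the factor is constant.\<close>
  have weight: "(\<Prod>v\<in>V. w (\<tau> (R `` {v}))) = (\<Prod>C\<in>V // R. w (\<tau> C) ^ card C)" for \<tau>
  proof -
    have "(\<Prod>v\<in>V. w (\<tau> (R `` {v}))) = (\<Prod>v\<in>\<Union>(V // R). w (\<tau> (R `` {v})))"
      by (simp add: Union_quotient[OF equiv])
    also have "\<dots> = (\<Prod>C\<in>V // R. \<Prod>v\<in>C. w (\<tau> (R `` {v})))"
      using quotient_disj[OF equiv] finite_subset[OF in_quotient_imp_subset[OF equiv] \<open>finite V\<close>]
      by (subst prod.Union_disjoint) (auto simp: o_def)
    also have "\<dots> = (\<Prod>C\<in>V // R. w (\<tau> C) ^ card C)"
    proof (rule prod.cong[OF refl])
      fix C assume C: "C \<in> V // R"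
      have "R `` {v} = C" if "v \<in> C" for v
        using that C by (rule class_eq)
      then show "(\<Prod>v\<in>C. w (\<tau> (R `` {v}))) = w (\<tau> C) ^ card C"
        by simp
    qed
    finally show ?thesis .
  qed
  have "(\<Prod>C\<in>V // R. \<Sum>i\<in>S. w i ^ card C) =
      (\<Sum>\<tau> \<in> V // R \<rightarrow>\<^sub>E S. \<Prod>C\<in>V // R. w (\<tau> C) ^ card C)"
    using finC \<open>finite S\<close> by (rule prod_sum_PiE)
  also have "\<dots> =
      (\<Sum>\<sigma> | \<sigma> \<in> V \<rightarrow>\<^sub>E S \<and> (\<forall>(u, v) \<in> R. \<sigma> u = \<sigma> v). \<Prod>v\<in>V. w (\<sigma> v))"
  proof (rule sum.reindex_bij_witness)
    \<comment> \<open>The two directions of the bijection: compose with the class map, or evaluate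
      at a chosen representative of the class. Both are restricted to their domains so that they
      land in the extensional function spaces.\<close>
    let ?lift = "\<lambda>\<tau>. \<lambda>v\<in>V. \<tau> (R `` {v})"
    let ?descend = "\<lambda>\<sigma>. \<lambda>C\<in>V // R. \<sigma> (SOME v. v \<in> C)"
    show "?descend (?lift \<tau>) = \<tau>" if "\<tau> \<in> V // R \<rightarrow>\<^sub>E S" for \<tau>
      using that rep by (intro extensionalityI[of _ "V // R"]) (auto simp: PiE_iff)
    show "?lift \<tau> \<in> {\<sigma> \<in> V \<rightarrow>\<^sub>E S. \<forall>(u, v) \<in> R. \<sigma> u = \<sigma> v}" if "\<tau> \<in> V // R \<rightarrow>\<^sub>E S" for \<tau>
      using that R same_class by (auto simp: PiE_iff quotientI)
    show "?descend \<sigma> \<in> V // R \<rightarrow>\<^sub>E S"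
      if "\<sigma> \<in> {\<sigma> \<in> V \<rightarrow>\<^sub>E S. \<forall>(u, v) \<in> R. \<sigma> u = \<sigma> v}" for \<sigma>
      using that rep by (auto simp: PiE_iff)
    show "?lift (?descend \<sigma>) = \<sigma>"
      if \<sigma>: "\<sigma> \<in> {\<sigma> \<in> V \<rightarrow>\<^sub>E S. \<forall>(u, v) \<in> R. \<sigma> u = \<sigma> v}" for \<sigma>
    proof
      fix v
      show "?lift (?descend \<sigma>) v = \<sigma> v"
      proof (cases "v \<in> V")
        case True
        then have "R `` {v} \<in> V // R"
          by (rule quotientI)
        \<comment> \<open>The representative chosen for the class of \<open>v\<close> may differ
          from \<open>v\<close>, but it is related to \<open>v\<close>, so \<open>\<sigma>\<close>
          gives both the same colour.\<close>
        then have "(v, SOME u. u \<in> R `` {v}) \<in> R"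
          using rep(1) by blast
        then have "\<sigma> (SOME u. u \<in> R `` {v}) = \<sigma> v"
          using \<sigma> by auto
        then show ?thesis
          using True \<open>R `` {v} \<in> V // R\<close> by simp
      next
        case False
        then show ?thesis
          \<comment> \<open>Outside \<open>V\<close> both functions take the value
            \<open>undefined\<close>.\<close>
          using \<sigma> PiE_arb[of \<sigma> V "\<lambda>_. S" v] by simp
      qed
    qed
    show "(\<Prod>v\<in>V. w (?lift \<tau> v)) = (\<Prod>C\<in>V // R. w (\<tau> C) ^ card C)" for \<tau>
      using weight by simp
  qed
  finally show ?thesis by simp
qed

lemma edge_delta_eq_1_iff:
  assumes "ends G e = Upair u v"
  shows "edge_delta G \<sigma> e = 1 \<longleftrightarrow> \<sigma> u = \<sigma> v"
  by (simp add: edge_delta_Upair[OF assms])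

lemma edge_delta_cases: "edge_delta G \<sigma> e = 0 \<or> edge_delta G \<sigma> e = 1"
proof (cases "ends G e")
  case (Upair u v)
  then show ?thesis by (simp add: edge_delta_Upair[OF Upair(1)])
qed

text \<open>An edge of \<open>A\<close> joins two connected vertices, which lie in
  \<open>verts G\<close> because \<open>A\<close> consists of edges of \<open>G\<close>. Conversely,
  equality of colours propagates along a path by induction on its length.\<close>

lemma respects_connectivity_iff:
  assumes "finite_multigraph G" and A: "A \<subseteq> edges G"
  shows "(\<forall>(u, v) \<in> connectivity (spanning_subgraph G A). \<sigma> u = \<sigma> v) \<longleftrightarrow>
    (\<forall>e\<in>A. edge_delta G \<sigma> e = 1)"
proof
  let ?H = "spanning_subgraph G A"
  assume const: "\<forall>(u, v) \<in> connectivity ?H. \<sigma> u = \<sigma> v"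
  show "\<forall>e\<in>A. edge_delta G \<sigma> e = 1"
  proof
    fix e assume e: "e \<in> A"
    obtain u v where uv: "ends G e = Upair u v" by (cases "ends G e")
    have "set_uprod (ends G e) \<subseteq> verts G"
      using finite_multigraph.ends_in_verts[OF assms(1)] A e by blast
    moreover have "adjacent ?H u v"
      using e uv by (auto simp: adjacent_def spanning_subgraph_def)
    ultimately have "(u, v) \<in> connectivity ?H"
      by (simp add: connectivity_def uv spanning_subgraph_def r_into_rtranclp)
    then have "\<sigma> u = \<sigma> v" using const by blast
    then show "edge_delta G \<sigma> e = 1" by (simp add: edge_delta_eq_1_iff[OF uv])
  qed
next
  let ?H = "spanning_subgraph G A"
  assume mono: "\<forall>e\<in>A. edge_delta G \<sigma> e = 1"
  have step: "\<sigma> u = \<sigma> v" if "adjacent ?H u v" for u v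
    using that mono by (auto simp: adjacent_def spanning_subgraph_def dest: edge_delta_eq_1_iff)
  have "\<sigma> u = \<sigma> v" if "(adjacent ?H)\<^sup>*\<^sup>* u v" for u v
    using that by induction (simp_all add: step)
  then show "\<forall>(u, v) \<in> connectivity ?H. \<sigma> u = \<sigma> v"
    by (auto simp: connectivity_def)
qed

lemma exp_sum_edge_delta:
  assumes fin: "finite (edges G)"
  shows "exp (\<beta> * (\<Sum>e \<in> edges G. J * edge_delta G \<sigma> e)) =
    (\<Sum>A \<in> Pow (edges G).
      if \<forall>e\<in>A. edge_delta G \<sigma> e = 1 then (exp (\<beta> * J) - 1) ^ card A else 0)"
proof -
  let ?x = "exp (\<beta> * J) - 1"
  have "exp (\<beta> * (\<Sum>e \<in> edges G. J * edge_delta G \<sigma> e)) =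
      (\<Prod>e \<in> edges G. exp (\<beta> * (J * edge_delta G \<sigma> e)))"
    by (simp add: sum_distrib_left exp_sum fin)
  \<comment> \<open>Both factors equal 1 when the delta is 0, and \<open>exp (\<beta> * J)\<close>
    when it is 1.\<close>
  also have "\<dots> = (\<Prod>e \<in> edges G. ?x * edge_delta G \<sigma> e + 1)"
  proof (rule prod.cong[OF refl])
    show "exp (\<beta> * (J * edge_delta G \<sigma> e)) = ?x * edge_delta G \<sigma> e + 1" for e
      using edge_delta_cases[of G \<sigma> e] by auto
  qed
  \<comment> \<open>\<open>A\<close> is the set of edges from which the first summand is taken; the
    edges outside \<open>A\<close> contribute factors 1.\<close>
  also have "\<dots> = (\<Sum>A \<in> Pow (edges G). \<Prod>e\<in>A. ?x * edge_delta G \<sigma> e)"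
    by (simp add: prod_add fin)
  also have "\<dots> = (\<Sum>A \<in> Pow (edges G).
      if \<forall>e\<in>A. edge_delta G \<sigma> e = 1 then ?x ^ card A else 0)"
  proof (rule sum.cong[OF refl])
    fix A assume "A \<in> Pow (edges G)"
    then have "finite A" using fin finite_subset by blast
    then show "(\<Prod>e\<in>A. ?x * edge_delta G \<sigma> e) =
        (if \<forall>e\<in>A. edge_delta G \<sigma> e = 1 then ?x ^ card A else 0)"
      \<comment> \<open>If some edge of \<open>A\<close> has delta 0, the whole product vanishes;
        otherwise every factor is \<open>?x\<close>.\<close>
      using edge_delta_cases[of G \<sigma>] by (force simp: prod_zero_iff)
  qed
  finally show ?thesis .
qed

theorem corollary1:
  fixes G :: "('v, 'e) multigraph" and q k :: nat and r \<beta> J x :: real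
  assumes "finite_multigraph G"
    and "x = exp (\<beta> * J) - 1"
  shows "dichromatic r q G x k =
    (\<Sum>\<sigma> \<in> verts G \<rightarrow>\<^sub>E {..<k}.
      exp (\<beta> * (\<Sum>e \<in> edges G. J * edge_delta G \<sigma> e)) * r ^ (\<Sum>v \<in> verts G. q ^ \<sigma> v))"
proof -
  interpret finite_multigraph G by fact
  let ?\<Sigma> = "verts G \<rightarrow>\<^sub>E {..<k}"
  let ?mono = "\<lambda>A \<sigma>. \<forall>e\<in>A. edge_delta G \<sigma> e = 1"
  let ?wt = "\<lambda>\<sigma>. \<Prod>v\<in>verts G. r ^ q ^ \<sigma> v"
  have fin: "finite ?\<Sigma>"
    using finite_verts by (simp add: finite_PiE)
  have comp: "(\<Prod>C \<in> components (spanning_subgraph G A). \<Sum>i<k. r ^ (card C * q ^ i)) =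
      (\<Sum>\<sigma> \<in> ?\<Sigma>. if ?mono A \<sigma> then ?wt \<sigma> else 0)" if "A \<subseteq> edges G" for A
  proof -
    let ?R = "connectivity (spanning_subgraph G A)"
    have verts: "verts (spanning_subgraph G A) = verts G"
      by (simp add: spanning_subgraph_def)
    \<comment> \<open>Writing the summand as a \<open>card C\<close>-th power exhibits
      \<open>r ^ q ^ i\<close> as the weight of a single vertex of colour \<open>i\<close>.\<close>
    have "(\<Prod>C \<in> components (spanning_subgraph G A). \<Sum>i<k. r ^ (card C * q ^ i)) =
        (\<Prod>C \<in> verts G // ?R. \<Sum>i<k. (r ^ q ^ i) ^ card C)"
      by (simp add: components_def verts mult.commute flip: power_mult)
    also have "\<dots> = (\<Sum>\<sigma> | \<sigma> \<in> ?\<Sigma> \<and> (\<forall>(u, v) \<in> ?R. \<sigma> u = \<sigma> v). ?wt \<sigma>)"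
      using equiv_connectivity[of "spanning_subgraph G A"] finite_verts
      by (subst sum_prod_respects_equiv) (simp_all add: verts)
    also have "\<dots> = (\<Sum>\<sigma> | \<sigma> \<in> ?\<Sigma> \<and> ?mono A \<sigma>. ?wt \<sigma>)"
      by (simp add: respects_connectivity_iff[OF assms(1) that])
    also have "\<dots> = (\<Sum>\<sigma> \<in> ?\<Sigma>. if ?mono A \<sigma> then ?wt \<sigma> else 0)"
      by (rule sum.inter_filter[OF fin])
    finally show ?thesis .
  qed
  have "dichromatic r q G x k =
      (\<Sum>A \<in> Pow (edges G). \<Sum>\<sigma> \<in> ?\<Sigma>. x ^ card A * (if ?mono A \<sigma> then ?wt \<sigma> else 0))"
    unfolding dichromatic_def sum_distrib_left[symmetric]
    by (rule sum.cong[OF refl]) (simp add: comp)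
  \<comment> \<open>After the sums are exchanged, the condition moves from the vertex weight, which
    does not depend on \<open>A\<close>, to the power of \<open>x\<close>. The inner sum is then the
    expansion of the Boltzmann weight of \<open>\<sigma>\<close>.\<close>
  also have "\<dots> = (\<Sum>\<sigma> \<in> ?\<Sigma>. \<Sum>A \<in> Pow (edges G).
      (if ?mono A \<sigma> then x ^ card A else 0) * ?wt \<sigma>)"
    by (subst sum.swap) (intro sum.cong refl, simp)
  also have "\<dots> = (\<Sum>\<sigma> \<in> ?\<Sigma>.
      exp (\<beta> * (\<Sum>e \<in> edges G. J * edge_delta G \<sigma> e)) * r ^ (\<Sum>v \<in> verts G. q ^ \<sigma> v))"
    unfolding exp_sum_edge_delta[OF finite_edges] assms(2) power_sum sum_distrib_right ..
  finally show ?thesis .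
qed

end
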